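(* Let $p$ be a prime, $n=p^2$, and let $\Gamma=\Gamma(D_{2n})$ be the intersection graph of $D_{2n}$. Then the hyper-Wiener index of $\Gamma$ is $WW(\Gamma)=\frac{1}{2}(6p^4+3p^3+6p^2+3p+2)$.
   Context: $D_{2n}=\langle r,s : r^n=s^2=1,\ srs=r^{-1}\rangle$ is the dihedral group of order $2n$. The intersection graph $\Gamma(G)$ of a finite group $G$ has as vertices the proper non-trivial subgroups of $G$, two distinct vertices being adjacent iff their intersection is non-trivial. With sums over unordered pairs of distinct vertices and $d$ the graph distance, $W(\Gamma)=\sum_{\{u,v\}} d(u,v)$ and the hyper-Wiener index is $WW(\Gamma)=\frac12 W(\Gamma)+\frac12\sum_{\{u,v\}} d(u,v)^2$. *)

theory Defs
  imports "Graph_Theory.Graph_Theory" "HOL-Algebra.Group" "HOL-Computational_Algebra.Primes"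
begin

section \<open>Groups given by a presentation\<close>

text \<open>
  A letter \<open>(a, True)\<close> stands for the generator \<open>a\<close> and \<open>(a, False)\<close> for its inverse; every element
  of the type \<open>'a\<close> is a generator. A relation \<open>u = v\<close> is the pair \<open>(u, v)\<close>.
\<close>

type_synonym 'a gword = "('a \<times> bool) list"

inductive word_eq :: "('a gword \<times> 'a gword) set \<Rightarrow> 'a gword \<Rightarrow> 'a gword \<Rightarrow> bool"
  for Rels where
  rel: "(u, v) \<in> Rels \<Longrightarrow> word_eq Rels u v"
| cancel: "word_eq Rels [(a, b), (a, \<not> b)] []"
| refl: "word_eq Rels u u"
| sym: "word_eq Rels u v \<Longrightarrow> word_eq Rels v u"
| trans: "word_eq Rels u v \<Longrightarrow> word_eq Rels v w \<Longrightarrow> word_eq Rels u w"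
| cong: "word_eq Rels u v \<Longrightarrow> word_eq Rels (x @ u @ y) (x @ v @ y)"

definition word_class :: "('a gword \<times> 'a gword) set \<Rightarrow> 'a gword \<Rightarrow> 'a gword set" where
  "word_class Rels u = {v. word_eq Rels u v}"

definition presented_group :: "('a gword \<times> 'a gword) set \<Rightarrow> 'a gword set monoid" where
  "presented_group Rels =
     \<lparr> carrier = range (word_class Rels),
       monoid.mult = (\<lambda>A B. \<Union>u\<in>A. \<Union>v\<in>B. word_class Rels (u @ v)),
       one = word_class Rels [] \<rparr>"

lemma word_class_eq_iff: "word_class Rels u = word_class Rels v \<longleftrightarrow> word_eq Rels u v"
proof
  assume "word_class Rels u = word_class Rels v"
  then have "v \<in> word_class Rels u" by (simp add: word_class_def word_eq.refl)
  then show "word_eq Rels u v" by (simp add: word_class_def)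
next
  assume uv: "word_eq Rels u v"
  then have vu: "word_eq Rels v u" by (rule word_eq.sym)
  show "word_class Rels u = word_class Rels v"
    using word_eq.trans[OF uv] word_eq.trans[OF vu] by (auto simp: word_class_def)
qed

lemma word_eq_append:
  assumes "word_eq Rels u u'" "word_eq Rels v v'"
  shows "word_eq Rels (u @ v) (u' @ v')"
proof (rule word_eq.trans)
  show "word_eq Rels (u @ v) (u' @ v)"
    using word_eq.cong[OF assms(1), of "[]" v] by simp
  show "word_eq Rels (u' @ v) (u' @ v')"
    using word_eq.cong[OF assms(2), of u' "[]"] by simp
qed

lemma presented_group_mult:
  "word_class Rels u \<otimes>\<^bsub>presented_group Rels\<^esub> word_class Rels v = word_class Rels (u @ v)"
proof -
  have "word_class Rels (x @ y) = word_class Rels (u @ v)"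
    if "x \<in> word_class Rels u" "y \<in> word_class Rels v" for x y
    using that unfolding word_class_eq_iff
    by (intro word_eq_append) (unfold word_class_def mem_Collect_eq, (erule word_eq.sym)+)
  moreover have "u \<in> word_class Rels u" "v \<in> word_class Rels v"
    by (simp_all add: word_class_def word_eq.refl)
  ultimately have "(\<Union>x\<in>word_class Rels u. \<Union>y\<in>word_class Rels v. word_class Rels (x @ y))
      = word_class Rels (u @ v)"
    by blast
  then show ?thesis
    by (simp add: presented_group_def)
qed

lemma word_eq_inverse: "word_eq Rels (map (apsnd Not) (rev u) @ u) []"
proof (induction u)
  case Nil
  show ?case by (simp add: word_eq.refl)
next
  case (Cons l u)
  obtain a b where l: "l = (a, b)" by force
  have "word_eq Rels (map (apsnd Not) (rev u) @ [(a, \<not> b), (a, \<not> \<not> b)] @ u)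
      (map (apsnd Not) (rev u) @ [] @ u)"
    by (rule word_eq.cong[OF word_eq.cancel])
  then have "word_eq Rels (map (apsnd Not) (rev (l # u)) @ l # u) (map (apsnd Not) (rev u) @ u)"
    by (simp add: l)
  then show ?case
    using Cons.IH by (rule word_eq.trans)
qed

lemma group_presented_group: "group (presented_group Rels)"
proof (rule groupI)
  let ?G = "presented_group Rels"
  have carr: "carrier ?G = range (word_class Rels)" and one: "\<one>\<^bsub>?G\<^esub> = word_class Rels []"
    by (simp_all add: presented_group_def)
  show "\<one>\<^bsub>?G\<^esub> \<in> carrier ?G" by (simp add: carr one)
  show "x \<otimes>\<^bsub>?G\<^esub> y \<in> carrier ?G" if "x \<in> carrier ?G" "y \<in> carrier ?G" for x y
    using that by (auto simp: carr presented_group_mult)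
  show "x \<otimes>\<^bsub>?G\<^esub> y \<otimes>\<^bsub>?G\<^esub> z = x \<otimes>\<^bsub>?G\<^esub> (y \<otimes>\<^bsub>?G\<^esub> z)"
    if "x \<in> carrier ?G" "y \<in> carrier ?G" "z \<in> carrier ?G" for x y z
    using that by (auto simp: carr presented_group_mult)
  show "\<one>\<^bsub>?G\<^esub> \<otimes>\<^bsub>?G\<^esub> x = x" if "x \<in> carrier ?G" for x
    using that by (auto simp: carr one presented_group_mult)
  show "\<exists>y\<in>carrier ?G. y \<otimes>\<^bsub>?G\<^esub> x = \<one>\<^bsub>?G\<^esub>" if x: "x \<in> carrier ?G" for x
  proof -
    obtain u where u: "x = word_class Rels u" using x by (auto simp: carr)
    have "word_class Rels (map (apsnd Not) (rev u)) \<otimes>\<^bsub>?G\<^esub> x = \<one>\<^bsub>?G\<^esub>"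
      by (simp only: u one presented_group_mult word_class_eq_iff word_eq_inverse)
    then show ?thesis by (auto simp: carr)
  qed
qed

section \<open>The dihedral group of order \<open>2n\<close>\<close>

datatype dihedral_gen = Rot | Ref

text \<open>\<open>D\<^sub>2\<^sub>n\<close> is \<open>dihedral_group n\<close>: the parameter is \<open>n\<close>, not the order.\<close>

definition dihedral_group :: "nat \<Rightarrow> dihedral_gen gword set monoid" where
  "dihedral_group n = presented_group
     {(replicate n (Rot, True), []),
      ([(Ref, True), (Ref, True)], []),
      ([(Ref, True), (Rot, True), (Ref, True)], [(Rot, False)])}"

section \<open>The intersection graph of a group\<close>

text \<open>Undirected simple graphs are represented, as in \<^locale>\<open>pair_graph\<close>, by a symmetric
  irreflexive set of arcs.\<close>

definition intersection_graph :: "('a, 'b) monoid_scheme \<Rightarrow> 'a set pair_pre_digraph" where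
  "intersection_graph G =
    (let V = {H. subgroup H G \<and> H \<noteq> {\<one>\<^bsub>G\<^esub>} \<and> H \<noteq> carrier G}
     in \<lparr> pverts = V,
          parcs = {(H, K). H \<in> V \<and> K \<in> V \<and> H \<noteq> K \<and> H \<inter> K \<noteq> {\<one>\<^bsub>G\<^esub>}} \<rparr>)"

lemma pair_graph_intersection_graph:
  assumes "finite (carrier G)"
  shows "pair_graph (intersection_graph G)"
proof
  let ?V = "pverts (intersection_graph G)"
  have "?V \<subseteq> Pow (carrier G)"
    by (auto simp: intersection_graph_def Let_def dest: subgroup.subset)
  then show fin: "finite ?V"
    using assms by (meson finite_Pow_iff finite_subset)
  have "parcs (intersection_graph G) \<subseteq> ?V \<times> ?V"
    by (auto simp: intersection_graph_def Let_def)
  then show "finite (parcs (intersection_graph G))"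
    using fin by (meson finite_SigmaI finite_subset)
  show "symmetric (with_proj (intersection_graph G))"
    unfolding symmetric_def with_proj_simps
    by (rule symI) (simp add: intersection_graph_def Let_def, blast)
qed (simp_all add: intersection_graph_def Let_def split: prod.splits)

section \<open>Distance, Wiener index and hyper-Wiener index\<close>

text \<open>Distances are extended reals, \<open>\<infinity>\<close> between vertices in different components.\<close>

definition gdist :: "'a pair_pre_digraph \<Rightarrow> 'a \<Rightarrow> 'a \<Rightarrow> ereal" where
  "gdist \<Gamma> u v = wf_digraph.\<mu> (with_proj \<Gamma>) (\<lambda>_. 1) u v"

definition vertex_pairs :: "'a pair_pre_digraph \<Rightarrow> 'a set set" where
  "vertex_pairs \<Gamma> = {{u, v} | u v. u \<in> pverts \<Gamma> \<and> v \<in> pverts \<Gamma> \<and> u \<noteq> v}"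

text \<open>Well defined on unordered pairs because the distance of a graph is symmetric; see
  \<open>pair_dist_eq\<close> below.\<close>

definition pair_dist :: "'a pair_pre_digraph \<Rightarrow> 'a set \<Rightarrow> ereal" where
  "pair_dist \<Gamma> e = (THE d. \<exists>u v. e = {u, v} \<and> d = gdist \<Gamma> u v)"

definition wiener_index :: "'a pair_pre_digraph \<Rightarrow> ereal" where
  "wiener_index \<Gamma> = (\<Sum>e\<in>vertex_pairs \<Gamma>. pair_dist \<Gamma> e)"

definition hyper_wiener_index :: "'a pair_pre_digraph \<Rightarrow> ereal" where
  "hyper_wiener_index \<Gamma> =
     1 / 2 * wiener_index \<Gamma> + 1 / 2 * (\<Sum>e\<in>vertex_pairs \<Gamma>. (pair_dist \<Gamma> e)\<^sup>2)"

lemma gdist_commute: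
  assumes "pair_graph \<Gamma>"
  shows "gdist \<Gamma> u v = gdist \<Gamma> v u"
proof -
  interpret pair_graph \<Gamma> by fact
  have arc: "(y, x) \<in> parcs \<Gamma>" if "(x, y) \<in> parcs \<Gamma>" for x y
    using that sym_arcs by (auto simp: symmetric_def sym_def)
  have ex: "\<exists>q. awalk y q x \<and> length q = length p" if "awalk x p y" for x p y
    using that
  proof (induction p arbitrary: x)
    case Nil
    then show ?case by (auto simp: awalk_Nil_iff)
  next
    case (Cons e p)
    obtain a b where e: "e = (a, b)" by force
    have ab: "(a, b) \<in> parcs \<Gamma>" "x = a" "awalk b p y"
      using Cons.prems by (auto simp: awalk_Cons_iff e)
    obtain q where q: "awalk y q b" "length q = length p"
      using Cons.IH[OF ab(3)] by blast
    have "awalk b [(b, a)] a"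
      using arc[OF ab(1)] in_arcsD2[OF ab(1)] in_arcsD1[OF ab(1)]
      by (auto simp: awalk_Cons_iff awalk_Nil_iff)
    with q ab show ?case
      by (intro exI[of _ "q @ [(b, a)]"]) (simp add: awalk_appendI)
  qed
  have cost: "awalk_cost (\<lambda>_. 1) p = real (length p)" for p :: "('a \<times> 'a) awalk"
    by (induction p) auto
  have le: "\<mu> (\<lambda>_. 1) x y \<le> \<mu> (\<lambda>_. 1) y x" for x y
    unfolding \<mu>_def
  proof (rule INF_mono)
    fix p assume "p \<in> {p. awalk y p x}"
    then obtain q where "awalk x q y" "length q = length p" using ex by blast
    then show "\<exists>q\<in>{p. awalk x p y}. ereal (awalk_cost (\<lambda>_. 1) q) \<le> ereal (awalk_cost (\<lambda>_. 1) p)"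
      by (intro bexI[of _ q]) (simp_all add: cost)
  qed
  show ?thesis
    unfolding gdist_def by (intro antisym le)
qed

lemma pair_dist_eq:
  assumes "pair_graph \<Gamma>"
  shows "pair_dist \<Gamma> {u, v} = gdist \<Gamma> u v"
  unfolding pair_dist_def
  by (rule the_equality) (auto simp: doubleton_eq_iff gdist_commute[OF assms])

end

theory Submission
  imports Defs "HOL-Number_Theory.Cong"
begin

text \<open>
  A word in \<open>r, s\<close> has a reflection sign and a rotation exponent modulo \<open>n\<close>, both invariant under
  the relations; this makes the normal forms \<open>r\<^sup>i\<close>, \<open>r\<^sup>i s\<close> with \<open>0 \<le> i < n\<close> distinct. For \<open>n = p\<^sup>2\<close>
  the vertices are \<open>\<langle>r\<rangle>\<close>, \<open>\<langle>r\<^sup>p\<rangle>\<close>, the \<open>p\<close> groups \<open>\<langle>r\<^sup>p, r\<^sup>i s\<rangle>\<close> and the \<open>p\<^sup>2\<close> groups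
  \<open>\<langle>r\<^sup>j s\<rangle>\<close>. All but the last contain \<open>r\<^sup>p\<close> and so form a clique, while \<open>\<langle>r\<^sup>j s\<rangle>\<close> is a pendant
  vertex attached to \<open>\<langle>r\<^sup>p, r\<^sup>j s\<rangle>\<close>. Two pendant vertices thus have distance 2 or 3 according to
  whether they share their neighbour, and the index is obtained by counting.
\<close>

section \<open>The dihedral group\<close>

fun word_sign :: "dihedral_gen gword \<Rightarrow> int" where
  "word_sign [] = 1"
| "word_sign ((Rot, b) # w) = word_sign w"
| "word_sign ((Ref, b) # w) = - word_sign w"

text \<open>Words act on the integers, with \<open>Rot\<close> as translation by 1 and
  \<open>Ref\<close> as negation. The word \<open>w\<close> then acts as the affine map sending x to
  \<open>word_exp w + word_sign w * x\<close>, and the append lemmas are the composition law of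
  these maps.\<close>

fun word_exp :: "dihedral_gen gword \<Rightarrow> int" where
  "word_exp [] = 0"
| "word_exp ((Rot, b) # w) = (if b then 1 else - 1) + word_exp w"
| "word_exp ((Ref, b) # w) = - word_exp w"

lemma word_sign_append: "word_sign (u @ v) = word_sign u * word_sign v"
  by (induction u rule: word_sign.induct) auto

lemma word_exp_append: "word_exp (u @ v) = word_exp u + word_sign u * word_exp v"
  by (induction u rule: word_exp.induct) auto

lemma word_sign_replicate_Rot: "word_sign (replicate k (Rot, b)) = 1"
  by (induction k) auto

lemma word_exp_replicate_Rot: "word_exp (replicate k (Rot, True)) = int k"
  by (induction k) auto

abbreviation dihedral_rels :: "nat \<Rightarrow> (dihedral_gen gword \<times> dihedral_gen gword) set" where
  "dihedral_rels n \<equiv>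
     {(replicate n (Rot, True), []),
      ([(Ref, True), (Ref, True)], []),
      ([(Ref, True), (Rot, True), (Ref, True)], [(Rot, False)])}"

text \<open>Only the relation r^n = 1 moves the exponent, and it does so by \<open>n\<close>; the
  other two relations and free cancellation preserve it exactly. Contexts add the same terms on both
  sides and multiply by a common sign.\<close>

lemma word_eq_dihedral_invariants:
  assumes "word_eq (dihedral_rels n) u v"
  shows "word_sign u = word_sign v" and "[word_exp u = word_exp v] (mod int n)"
proof -
  have "word_sign u = word_sign v \<and> [word_exp u = word_exp v] (mod int n)"
    using assms
  proof induction
    case (rel u v)
    then show ?case
      by (auto simp: word_sign_replicate_Rot word_exp_replicate_Rot cong_def)
  next
    case (cancel a b)
    then show ?case by (cases a) auto
  next
    case (cong u v x y)
    then show ?case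
      by (auto simp: word_sign_append word_exp_append intro!: cong_add cong_mult)
  qed (auto intro: cong_sym cong_trans)
  then show "word_sign u = word_sign v" "[word_exp u = word_exp v] (mod int n)" by auto
qed

section \<open>Normal forms and multiplication table\<close>

text \<open>Here \<open>rot i\<close> is r^i and \<open>ref i\<close> is r^i s. Integer indices,
  identified modulo \<open>n\<close>, turn questions about subgroups into questions of
  divisibility.\<close>

locale dihedral = group G for G (structure) +
  fixes n :: nat and rot ref :: "int \<Rightarrow> 'a"
  assumes carrier_eq: "carrier G = range rot \<union> range ref"
    and rot_rot: "rot i \<otimes> rot j = rot (i + j)"
    and rot_ref: "rot i \<otimes> ref j = ref (i + j)"
    and ref_rot: "ref i \<otimes> rot j = ref (i - j)"
    and ref_ref: "ref i \<otimes> ref j = rot (i - j)"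
    and rot_eq_iff: "rot i = rot j \<longleftrightarrow> int n dvd i - j"
    and ref_eq_iff: "ref i = ref j \<longleftrightarrow> int n dvd i - j"
    and rot_neq_ref: "rot i \<noteq> ref j"

text \<open>The multiplication table follows from s^2 = 1 and srs = r^-1, and the distinctness of
  the normal forms from the word invariants.\<close>

lemma dihedral_dihedral_group: "\<exists>rot ref. dihedral (dihedral_group n) n rot ref"
proof -
  define G where "G = dihedral_group n"
  let ?c = "word_class (dihedral_rels n)"
  have G: "G = presented_group (dihedral_rels n)"
    by (simp add: G_def dihedral_group_def)
  interpret group G unfolding G by (rule group_presented_group)
  have mult: "?c u \<otimes>\<^bsub>G\<^esub> ?c v = ?c (u @ v)" for u v
    unfolding G by (rule presented_group_mult)
  have carr: "carrier G = range ?c" and one: "\<one>\<^bsub>G\<^esub> = ?c []"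
    by (simp_all add: G presented_group_def)
  define r where "r = ?c [(Rot, True)]"
  define s where "s = ?c [(Ref, True)]"
  define rot where "rot i = r [^]\<^bsub>G\<^esub> i" for i :: int
  define ref where "ref i = rot i \<otimes>\<^bsub>G\<^esub> s" for i :: int
  have r: "r \<in> carrier G" and s: "s \<in> carrier G" by (auto simp: carr r_def s_def)
  have rotc: "rot i \<in> carrier G" for i using r by (simp add: rot_def)
  have inv_gen: "inv\<^bsub>G\<^esub> (?c [(a, True)]) = ?c [(a, False)]" for a
    by (rule inv_equality)
      (auto simp: mult one carr word_class_eq_iff intro: word_eq.cancel[where b = False, simplified])
  have ss: "s \<otimes>\<^bsub>G\<^esub> s = \<one>\<^bsub>G\<^esub>"
    by (auto simp: s_def mult one word_class_eq_iff intro: word_eq.rel)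
  have inv_s: "inv\<^bsub>G\<^esub> s = s" using ss s by (simp add: inv_equality)
  have srs: "s \<otimes>\<^bsub>G\<^esub> r \<otimes>\<^bsub>G\<^esub> s = inv\<^bsub>G\<^esub> r"
    unfolding r_def s_def inv_gen mult word_class_eq_iff by (auto intro: word_eq.rel)
  have rot_rot: "rot i \<otimes>\<^bsub>G\<^esub> rot j = rot (i + j)" for i j
    using r by (simp add: rot_def int_pow_mult)
  have rot1: "rot 1 = r" and rotm1: "rot (-1) = inv\<^bsub>G\<^esub> r" and rot0: "rot 0 = \<one>\<^bsub>G\<^esub>"
    using r by (simp_all add: rot_def int_pow_neg)
  have s_rot_s: "s \<otimes>\<^bsub>G\<^esub> rot i \<otimes>\<^bsub>G\<^esub> s = rot (- i)" for i
  proof -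
    \<comment> \<open>Since s^2 = 1, conjugation by s is an endomorphism, so srs = r^-1 extends to
      all powers of r.\<close>
    have hom: "(\<lambda>x. s \<otimes>\<^bsub>G\<^esub> x \<otimes>\<^bsub>G\<^esub> s) \<in> hom G G"
    proof (rule homI)
      fix x y assume xy: "x \<in> carrier G" "y \<in> carrier G"
      have "s \<otimes>\<^bsub>G\<^esub> x \<otimes>\<^bsub>G\<^esub> s \<otimes>\<^bsub>G\<^esub> (s \<otimes>\<^bsub>G\<^esub> y \<otimes>\<^bsub>G\<^esub> s)
          = s \<otimes>\<^bsub>G\<^esub> x \<otimes>\<^bsub>G\<^esub> (s \<otimes>\<^bsub>G\<^esub> s) \<otimes>\<^bsub>G\<^esub> y \<otimes>\<^bsub>G\<^esub> s"
        using xy s by (simp only: m_assoc m_closed)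
      then show "s \<otimes>\<^bsub>G\<^esub> (x \<otimes>\<^bsub>G\<^esub> y) \<otimes>\<^bsub>G\<^esub> s
          = s \<otimes>\<^bsub>G\<^esub> x \<otimes>\<^bsub>G\<^esub> s \<otimes>\<^bsub>G\<^esub> (s \<otimes>\<^bsub>G\<^esub> y \<otimes>\<^bsub>G\<^esub> s)"
        using xy s by (simp add: ss m_assoc)
    qed (use s in auto)
    show ?thesis
      using hom_int_pow[OF hom r is_group is_group, of i] r
      by (simp add: rot_def srs int_pow_inv int_pow_neg)
  qed
  have s_rot: "s \<otimes>\<^bsub>G\<^esub> rot i = rot (- i) \<otimes>\<^bsub>G\<^esub> s" for i
  proof -
    have "s \<otimes>\<^bsub>G\<^esub> rot i \<otimes>\<^bsub>G\<^esub> s \<otimes>\<^bsub>G\<^esub> s = s \<otimes>\<^bsub>G\<^esub> rot i"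
      using s rotc by (simp add: m_assoc ss)
    then show ?thesis by (simp add: s_rot_s)
  qed
  have rot_ref: "rot i \<otimes>\<^bsub>G\<^esub> ref j = ref (i + j)" for i j
    using s rotc by (simp add: ref_def rot_rot flip: m_assoc)
  have ref_rot: "ref i \<otimes>\<^bsub>G\<^esub> rot j = ref (i - j)" for i j
  proof -
    have "ref i \<otimes>\<^bsub>G\<^esub> rot j = rot i \<otimes>\<^bsub>G\<^esub> (s \<otimes>\<^bsub>G\<^esub> rot j)"
      using s rotc by (simp add: ref_def m_assoc)
    also have "\<dots> = rot i \<otimes>\<^bsub>G\<^esub> rot (- j) \<otimes>\<^bsub>G\<^esub> s"
      using s rotc by (simp add: s_rot m_assoc)
    finally show ?thesis by (simp add: rot_rot ref_def)
  qed
  have ref_ref: "ref i \<otimes>\<^bsub>G\<^esub> ref j = rot (i - j)" for i j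
  proof -
    have "ref i \<otimes>\<^bsub>G\<^esub> ref j = (ref i \<otimes>\<^bsub>G\<^esub> rot j) \<otimes>\<^bsub>G\<^esub> s"
      using s rotc by (simp add: ref_def m_assoc)
    also have "\<dots> = rot (i - j) \<otimes>\<^bsub>G\<^esub> (s \<otimes>\<^bsub>G\<^esub> s)"
      using s rotc by (simp add: ref_rot) (simp add: ref_def m_assoc)
    finally show ?thesis using rotc by (simp add: ss)
  qed
  \<comment> \<open>Each \<open>rot i\<close> gets a representative with known invariants, so that
    equal classes can be compared through them. The exponent is exactly \<open>i\<close>; reduction
    modulo \<open>n\<close> enters only with the invariance lemma.\<close>
  have rot_word: "\<exists>w. rot i = ?c w \<and> word_sign w = 1 \<and> word_exp w = i" for i
  proof (induction i rule: int_induct[where k = 0])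
    case base
    show ?case by (intro exI[of _ "[]"]) (simp add: rot0 one)
  next
    case (step1 i)
    then obtain w where "rot i = ?c w" "word_sign w = 1" "word_exp w = i" by blast
    moreover have "rot (i + 1) = ?c [(Rot, True)] \<otimes>\<^bsub>G\<^esub> rot i"
      using rot_rot[of 1 i] by (simp add: rot1 r_def add.commute)
    ultimately show ?case by (intro exI[of _ "(Rot, True) # w"]) (simp add: mult)
  next
    case (step2 i)
    then obtain w where "rot i = ?c w" "word_sign w = 1" "word_exp w = i" by blast
    moreover have "rot (i - 1) = ?c [(Rot, False)] \<otimes>\<^bsub>G\<^esub> rot i"
      using rot_rot[of "-1" i] by (simp add: rotm1 r_def inv_gen)
    ultimately show ?case by (intro exI[of _ "(Rot, False) # w"]) (simp add: mult)
  qed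
  have ref_word: "\<exists>w. ref i = ?c w \<and> word_sign w = - 1" for i
  proof -
    obtain w where "rot i = ?c w" "word_sign w = 1" using rot_word by blast
    then show ?thesis
      by (intro exI[of _ "w @ [(Ref, True)]"]) (simp add: ref_def s_def mult word_sign_append)
  qed
  have rot_n: "rot (int n) = \<one>\<^bsub>G\<^esub>"
  proof -
    have "rot (int k) = ?c (replicate k (Rot, True))" for k
    proof (induction k)
      case (Suc k)
      then show ?case using rot_rot[of 1 "int k"] by (simp add: rot1 r_def mult)
    qed (simp add: rot0 one)
    then show ?thesis by (auto simp: one word_class_eq_iff intro: word_eq.rel)
  qed
  have rot_eq_iff: "rot i = rot j \<longleftrightarrow> int n dvd i - j" for i j
  proof
    assume eq: "rot i = rot j"
    obtain u v where uv: "rot i = ?c u" "word_exp u = i" "rot j = ?c v" "word_exp v = j"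
      using rot_word by metis
    then have "word_eq (dihedral_rels n) u v" using eq by (metis word_class_eq_iff)
    then have "[i = j] (mod int n)" using word_eq_dihedral_invariants(2) uv by blast
    then show "int n dvd i - j" by (simp add: cong_iff_dvd_diff)
  next
    assume "int n dvd i - j"
    then obtain k where k: "i = j + int n * k" by (metis dvdE add.commute diff_add_cancel)
    have "rot (int n * k) = \<one>\<^bsub>G\<^esub>"
      using r rot_n int_pow_pow[OF r, of "int n" k] by (simp add: rot_def)
    then show "rot i = rot j"
      using rot_rot[of j "int n * k"] rotc by (simp add: k)
  qed
  have ref_eq_iff: "ref i = ref j \<longleftrightarrow> int n dvd i - j" for i j
    using s rotc by (simp add: ref_def rot_eq_iff)
  have rot_neq_ref: "rot i \<noteq> ref j" for i j
    using rot_word[of i] ref_word[of j] word_eq_dihedral_invariants(1)[of n]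
    by (force simp: word_class_eq_iff)
  \<comment> \<open>The normal forms are closed under left multiplication by a letter, so induction
    on words shows that they exhaust the group.\<close>
  have "?c w \<in> range rot \<union> range ref" for w
  proof (induction w)
    case Nil
    then show ?case by (metis UnI1 one rangeI rot0)
  next
    case (Cons l w)
    have "?c [l] \<in> {rot 1, rot (-1), ref 0}"
    proof (cases l)
      case (Pair a b)
      have "ref 0 = s" using s by (simp add: ref_def rot0)
      then show ?thesis
        using inv_gen[of Rot] inv_gen[of Ref] inv_s
        by (cases a; cases b) (auto simp: Pair rot1 rotm1 r_def s_def)
    qed
    moreover have "?c (l # w) = ?c [l] \<otimes>\<^bsub>G\<^esub> ?c w" by (simp add: mult)
    ultimately show ?case
      using Cons.IH by (auto simp: rot_rot rot_ref ref_rot ref_ref)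
  qed
  moreover have "range rot \<union> range ref \<subseteq> carrier G"
    using rotc s by (auto simp: ref_def)
  ultimately have carrier_eq: "carrier G = range rot \<union> range ref"
    by (auto simp: carr)
  have "dihedral G n rot ref"
    by unfold_locales
      (auto simp: carrier_eq rot_rot rot_ref ref_rot ref_ref rot_eq_iff ref_eq_iff rot_neq_ref)
  then show ?thesis unfolding G_def by blast
qed


section \<open>Subgroups of the dihedral group\<close>

context dihedral
begin

definition rot_sub :: "int \<Rightarrow> 'a set" where
  "rot_sub d = {rot i |i. d dvd i}"

text \<open>This is the subgroup generated by r^d and r^j s. For \<open>d = 1\<close> it is the
  whole group, and for \<open>d = n\<close> it consists of the identity and one reflection.\<close>

definition dih_sub :: "int \<Rightarrow> int \<Rightarrow> 'a set" where
  "dih_sub d j = rot_sub d \<union> {ref i |i. d dvd i - j}"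

lemma rot_closed [simp]: "rot i \<in> carrier G" and ref_closed [simp]: "ref i \<in> carrier G"
  by (auto simp: carrier_eq)

lemma one_eq: "\<one> = rot 0"
  using rot_rot[of 0 0] by (simp add: l_cancel_one)

lemma inv_rot: "inv (rot i) = rot (- i)"
  by (rule inv_equality) (simp_all add: rot_rot one_eq)

lemma inv_ref: "inv (ref i) = ref i"
  by (rule inv_equality) (simp_all add: ref_ref one_eq)

lemma finite_carrier:
  assumes "n > 0"
  shows "finite (carrier G)"
proof -
  have "rot i = rot (i mod int n)" "ref i = ref (i mod int n)" for i
    by (simp_all add: rot_eq_iff ref_eq_iff)
  moreover have "i mod int n \<in> {0..<int n}" for i using assms by simp
  ultimately have "carrier G \<subseteq> rot ` {0..<int n} \<union> ref ` {0..<int n}"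
    unfolding carrier_eq by blast
  then show ?thesis by (rule finite_subset) simp
qed

text \<open>A rotation determines its exponent only modulo \<open>n\<close>; divisibility by
  \<open>d\<close> is well defined because \<open>d\<close> divides \<open>n\<close>.\<close>

lemma rot_mem_rot_sub_iff:
  assumes "d dvd int n"
  shows "rot i \<in> rot_sub d \<longleftrightarrow> d dvd i"
proof
  assume "rot i \<in> rot_sub d"
  then obtain k where k: "int n dvd i - k" "d dvd k"
    by (auto simp: rot_sub_def rot_eq_iff)
  have "d dvd (i - k) + k" using k assms by (meson dvd_add dvd_trans)
  then show "d dvd i" by simp
qed (auto simp: rot_sub_def)

lemma ref_mem_rot_sub_iff: "ref i \<notin> rot_sub d"
  unfolding rot_sub_def using rot_neq_ref by (auto simp: eq_commute)

lemma rot_mem_dih_sub_iff: "d dvd int n \<Longrightarrow> rot i \<in> dih_sub d j \<longleftrightarrow> d dvd i"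
  unfolding dih_sub_def using rot_neq_ref by (auto simp: rot_mem_rot_sub_iff)

lemma ref_mem_dih_sub_iff:
  assumes "d dvd int n"
  shows "ref i \<in> dih_sub d j \<longleftrightarrow> d dvd i - j"
proof
  assume "ref i \<in> dih_sub d j"
  then obtain k where k: "int n dvd i - k" "d dvd k - j"
    by (auto simp: dih_sub_def ref_mem_rot_sub_iff ref_eq_iff)
  have "d dvd (i - k) + (k - j)" using k assms by (meson dvd_add dvd_trans)
  then show "d dvd i - j" by simp
qed (auto simp: dih_sub_def)

lemma subgroup_rot_sub: "subgroup (rot_sub d) G"
  by (rule subgroupI) (auto simp: rot_sub_def rot_rot inv_rot)

lemma subgroup_dih_sub: "subgroup (dih_sub d j) G"
proof -
  have rotI: "rot i \<in> dih_sub d j" if "d dvd i" for i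
    using that by (auto simp: dih_sub_def rot_sub_def)
  have refI: "ref i \<in> dih_sub d j" if "d dvd i - j" for i
    using that by (auto simp: dih_sub_def)
  have elems: "(\<exists>i. a = rot i \<and> d dvd i) \<or> (\<exists>i. a = ref i \<and> d dvd i - j)"
    if "a \<in> dih_sub d j" for a
    using that by (auto simp: dih_sub_def rot_sub_def)
  show ?thesis
  proof (rule subgroupI)
    show "dih_sub d j \<subseteq> carrier G" using elems by force
    show "dih_sub d j \<noteq> {}" using rotI[of 0] by auto
    show "inv a \<in> dih_sub d j" if "a \<in> dih_sub d j" for a
      using elems[OF that] by (elim disjE exE conjE) (simp_all add: inv_rot inv_ref rotI refI)
    show "a \<otimes> b \<in> dih_sub d j" if a: "a \<in> dih_sub d j" and b: "b \<in> dih_sub d j" for a b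
    proof -
      have "d dvd i - k - j" if "d dvd i - j" "d dvd k" for i k
        using dvd_diff[OF that] by (simp add: algebra_simps)
      moreover have "d dvd i - k" if "d dvd i - j" "d dvd k - j" for i k
        using dvd_diff[OF that] by simp
      moreover have "d dvd i + k - j" if "d dvd i" "d dvd k - j" for i k
        using dvd_add[OF that] by (simp add: algebra_simps)
      ultimately show ?thesis
        using elems[OF a] elems[OF b]
        by (elim disjE exE conjE) (simp_all add: rot_rot rot_ref ref_rot ref_ref rotI refI)
    qed
  qed
qed

lemma dih_sub_cong:
  assumes "d dvd j - k"
  shows "dih_sub d j = dih_sub d k"
proof -
  have "d dvd i - j \<longleftrightarrow> d dvd i - k" for i
    using dvd_add_right_iff[OF assms, of "i - j"] by simp
  then show ?thesis by (simp add: dih_sub_def)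
qed

text \<open>The exponents of the rotations in \<open>H\<close> form an ideal of the integers. It
  contains \<open>n\<close>, so its least positive element \<open>d\<close> divides
  \<open>n\<close>. If \<open>H\<close> contains a reflection \<open>ref j\<close>, multiplication
  by it matches the reflections of \<open>H\<close> with its rotations.\<close>

lemma subgroup_cases:
  assumes "n > 0" and H: "subgroup H G"
  obtains d where "d dvd n" "H = rot_sub (int d)"
  | d j where "d dvd n" "H = dih_sub (int d) j"
proof -
  interpret H: subgroup H G by fact
  have rot_diff: "rot (i - j) \<in> H" if "rot i \<in> H" "rot j \<in> H" for i j
    using H.m_closed[OF that(1) H.m_inv_closed[OF that(2)]] by (simp add: inv_rot rot_rot)
  have rot_add: "rot (i + j) \<in> H" if "rot i \<in> H" "rot j \<in> H" for i j
    using H.m_closed[OF that] by (simp add: rot_rot)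
  have rot_mult: "rot (i * k) \<in> H" if "rot i \<in> H" for i k
  proof (induction k rule: int_induct[where k = 0])
    case base
    then show ?case using H.one_closed by (simp add: one_eq)
  qed (use that rot_add rot_diff in \<open>simp_all add: algebra_simps\<close>)
  define d where "d = (LEAST d. d > 0 \<and> rot (int d) \<in> H)"
  have "rot (int n) = \<one>" by (simp add: one_eq rot_eq_iff)
  then have "n > 0 \<and> rot (int n) \<in> H" using assms by simp
  then have d: "d > 0" "rot (int d) \<in> H"
    unfolding d_def by (rule LeastI2, simp)+
  have rot_mem: "rot i \<in> H \<longleftrightarrow> int d dvd i" for i
  proof
    assume i: "rot i \<in> H"
    \<comment> \<open>The remainder of \<open>i\<close> modulo \<open>d\<close> is again the
      exponent of a rotation in \<open>H\<close>, so minimality of \<open>d\<close> forces it to be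
      0.\<close>
    define m where "m = nat (i mod int d)"
    have m: "int m = i mod int d" using d by (simp add: m_def)
    have "rot (int m) \<in> H"
      unfolding m minus_mult_div_eq_mod[symmetric] using i d rot_mult rot_diff by blast
    moreover have "m < d" using d pos_mod_bound[of "int d" i] unfolding m[symmetric] by simp
    then have "\<not> (m > 0 \<and> rot (int m) \<in> H)"
      unfolding d_def by (rule not_less_Least)
    ultimately have "m = 0" by simp
    then show "int d dvd i" using m by (simp add: dvd_eq_mod_eq_0)
  next
    assume "int d dvd i"
    then show "rot i \<in> H" using d rot_mult by auto
  qed
  have "int d dvd int n" using rot_mem \<open>n > 0 \<and> rot (int n) \<in> H\<close> by blast
  then have dn: "d dvd n" by simp
  have H_sub: "H \<subseteq> range rot \<union> range ref" using H.subset carrier_eq by simp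
  show thesis
  proof (cases "\<exists>j. ref j \<in> H")
    case False
    then have "H = rot_sub (int d)"
      unfolding rot_sub_def rot_mem[symmetric] using H_sub by blast
    then show thesis using that dn by blast
  next
    case True
    then obtain j where j: "ref j \<in> H" by blast
    have ref_mem: "ref i \<in> H \<longleftrightarrow> int d dvd i - j" for i
    proof
      assume "ref i \<in> H"
      then show "int d dvd i - j"
        using H.m_closed[OF _ j, of "ref i"] by (simp add: ref_ref flip: rot_mem)
    next
      assume "int d dvd i - j"
      then show "ref i \<in> H"
        using H.m_closed[OF _ j, of "rot (i - j)"] by (simp add: rot_ref rot_mem)
    qed
    have "H = {rot i |i. rot i \<in> H} \<union> {ref i |i. ref i \<in> H}" using H_sub by blast
    also have "\<dots> = dih_sub (int d) j"
      unfolding rot_mem ref_mem dih_sub_def rot_sub_def ..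
    finally have "H = dih_sub (int d) j" .
    then show thesis using that dn by blast
  qed
qed

end

text \<open>\<open>RefSub i l\<close> stands for the subgroup generated by the reflection \<open>ref (i + p * l)\<close>;
  splitting its exponent this way makes \<open>Dih i\<close> the only subgroup of order \<open>2p\<close> that contains it.\<close>

datatype subgroup_index = RotAll | RotSub | Dih nat | RefSub nat nat

definition subgroup_indices :: "nat \<Rightarrow> subgroup_index set" where
  "subgroup_indices p =
     {RotAll, RotSub} \<union> Dih ` {..<p} \<union> (\<lambda>(i, l). RefSub i l) ` ({..<p} \<times> {..<p})"

lemma mem_subgroup_indices [simp]:
  "RotAll \<in> subgroup_indices p" "RotSub \<in> subgroup_indices p"
  "Dih i \<in> subgroup_indices p \<longleftrightarrow> i < p"
  "RefSub i l \<in> subgroup_indices p \<longleftrightarrow> i < p \<and> l < p"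
  by (auto simp: subgroup_indices_def)

text \<open>Meant for distinct indices: the diagonal value is \<open>True\<close> except at
  \<open>RefSub\<close>. Two \<open>RefSub\<close> indices fall under the first equation and are
  never adjacent.\<close>

fun index_adj :: "subgroup_index \<Rightarrow> subgroup_index \<Rightarrow> bool" where
  "index_adj (RefSub i l) x = (x = Dih i)"
| "index_adj x (RefSub i l) = (x = Dih i)"
| "index_adj x y = True"

text \<open>The final value 2 arises only between a \<open>RefSub\<close> and a clique vertex other
  than its neighbour. The value 3 is the path through two different \<open>Dih\<close>
  vertices.\<close>

fun index_dist :: "subgroup_index \<Rightarrow> subgroup_index \<Rightarrow> nat" where
  "index_dist (RefSub i l) (RefSub j m) = (if i = j then (if l = m then 0 else 2) else 3)"
| "index_dist x y = (if x = y then 0 else if index_adj x y then 1 else 2)"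

lemma dvd_diff_less_iff: "i < m \<Longrightarrow> j < m \<Longrightarrow> int m dvd int i - int j \<longleftrightarrow> i = j"
  by (auto simp flip: mod_eq_dvd_iff zmod_int)

section \<open>Subgroups and their intersections when n is the square of a prime\<close>

locale dihedral_prime_square = dihedral +
  fixes p :: nat
  assumes prime_p: "Factorial_Ring.prime p" and n_eq: "n = p ^ 2"
begin

fun index_sub :: "subgroup_index \<Rightarrow> 'a set" where
  "index_sub RotAll = rot_sub 1"
| "index_sub RotSub = rot_sub (int p)"
| "index_sub (Dih i) = dih_sub (int p) (int i)"
| "index_sub (RefSub i l) = dih_sub (int n) (int (i + p * l))"

lemma p_gt_1: "p > 1" using prime_p by (rule prime_gt_1_nat)

lemma n_pos: "n > 0" using p_gt_1 by (simp add: n_eq)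

lemma p_dvd_n: "int p dvd int n" by (simp add: n_eq)

lemma not_n_dvd_p: "\<not> n dvd p"
  using p_gt_1 by (auto simp: n_eq power2_eq_square dest: dvd_imp_le)

lemmas mem_sub_iff =
  rot_mem_rot_sub_iff[OF p_dvd_n] rot_mem_rot_sub_iff[OF one_dvd] rot_mem_rot_sub_iff[OF dvd_refl]
  rot_mem_dih_sub_iff[OF p_dvd_n] rot_mem_dih_sub_iff[OF one_dvd] rot_mem_dih_sub_iff[OF dvd_refl]
  ref_mem_dih_sub_iff[OF p_dvd_n] ref_mem_dih_sub_iff[OF one_dvd] ref_mem_dih_sub_iff[OF dvd_refl]
  ref_mem_rot_sub_iff

text \<open>In \<open>i + p * l\<close> the numbers \<open>i\<close> and \<open>l\<close> are
  base-\<open>p\<close> digits, \<open>i\<close> being the low one.\<close>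

lemma RefSub_exp_less:
  assumes "i < p" "l < p"
  shows "i + p * l < n"
proof -
  have "i + p * l < p * Suc l" using assms by simp
  also have "\<dots> \<le> p * p" using assms by (intro mult_left_mono) auto
  finally show ?thesis by (simp add: n_eq power2_eq_square)
qed

lemma RefSub_exp_eq_iff:
  assumes "i < p" "j < p"
  shows "i + p * l = j + p * m \<longleftrightarrow> i = j \<and> l = m"
proof
  assume eq: "i + p * l = j + p * m"
  have "(i + p * l) mod p = i" "(j + p * m) mod p = j" using assms by simp_all
  then show "i = j \<and> l = m" using eq p_gt_1 by simp
qed simp

text \<open>The divisors 1, p, p^2 of \<open>n\<close> give six families in
  \<open>subgroup_cases\<close>. Dropping the trivial group \<open>rot_sub n\<close> and the whole
  group \<open>dih_sub 1 j\<close> leaves the four constructors.\<close>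

lemma proper_subgroups_eq:
  "{H. subgroup H G \<and> H \<noteq> {\<one>} \<and> H \<noteq> carrier G} = index_sub ` subgroup_indices p"
proof (intro equalityI subsetI)
  fix H assume "H \<in> {H. subgroup H G \<and> H \<noteq> {\<one>} \<and> H \<noteq> carrier G}"
  then have H: "subgroup H G" "H \<noteq> {\<one>}" "H \<noteq> carrier G" by auto
  have d_cases: "d = 1 \<or> d = p \<or> d = n" if "d dvd n" for d
  proof -
    obtain k where "k \<le> 2" "d = p ^ k"
      using \<open>d dvd n\<close> prime_p unfolding n_eq by (auto simp: divides_primepow_nat)
    then show ?thesis by (auto simp: n_eq le_Suc_eq numeral_2_eq_2)
  qed
  have rot_sub_n: "rot_sub (int n) = {\<one>}"
    by (auto simp: rot_sub_def one_eq rot_eq_iff intro: exI[of _ 0])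
  have dih_sub_1: "dih_sub 1 j = carrier G" for j
    by (simp add: dih_sub_def rot_sub_def carrier_eq full_SetCompr_eq)
  from n_pos H(1) show "H \<in> index_sub ` subgroup_indices p"
  proof (cases rule: subgroup_cases)
    case (1 d)
    have "d \<noteq> n" using 1(2) H(2) rot_sub_n by blast
    then have "d = 1 \<or> d = p" using d_cases[OF 1(1)] by blast
    then have "H = index_sub RotAll \<or> H = index_sub RotSub"
      unfolding 1(2) by (elim disjE) simp_all
    then show ?thesis by (elim disjE) (simp_all only: imageI mem_subgroup_indices)
  next
    case (2 d j)
    have "d \<noteq> 1" using 2(2) H(3) dih_sub_1 by auto
    then consider "d = p" | "d = n" using d_cases[OF 2(1)] by blast
    then show ?thesis
    proof cases
      case 1
      \<comment> \<open>The group \<open>dih_sub p j\<close> depends only on \<open>j\<close> modulo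
        \<open>p\<close>.\<close>
      define i where "i = nat (j mod int p)"
      have i: "int i = j mod int p" "i < p"
        using p_gt_1 by (simp_all add: i_def nat_less_iff)
      have "H = index_sub (Dih i)"
        unfolding 2(2) 1 index_sub.simps by (rule dih_sub_cong) (simp add: i)
      then show ?thesis using i(2) by (simp only: imageI mem_subgroup_indices)
    next
      case d: 2
      define m where "m = nat (j mod int n)"
      have m: "int m = j mod int n" "m < n"
        using n_pos by (simp_all add: m_def nat_less_iff)
      \<comment> \<open>The residue of \<open>j\<close> modulo \<open>n\<close> is split into its
        two base-\<open>p\<close> digits.\<close>
      have "H = index_sub (RefSub (m mod p) (m div p))"
        unfolding 2(2) d index_sub.simps mod_mult_div_eq by (rule dih_sub_cong) (simp add: m(1))
      moreover have "m mod p < p" using p_gt_1 by simp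
      moreover have "m div p < p"
        using m(2) by (simp add: n_eq power2_eq_square less_mult_imp_div_less)
      ultimately show ?thesis by (simp only: imageI mem_subgroup_indices)
    qed
  qed
next
  fix H assume "H \<in> index_sub ` subgroup_indices p"
  then obtain x where x: "x \<in> subgroup_indices p" "H = index_sub x" by blast
  have H: "subgroup H G"
    unfolding x by (cases x) (simp_all add: subgroup_rot_sub subgroup_dih_sub)
  have "rot (int p) \<noteq> \<one>" "ref i \<noteq> \<one>" for i
    using not_n_dvd_p rot_neq_ref by (auto simp: one_eq rot_eq_iff eq_commute)
  moreover have "rot (int p) \<in> H \<or> (\<exists>i. ref i \<in> H)"
  proof (cases x)
    case (RefSub i l)
    then have "ref (int (i + p * l)) \<in> H" unfolding x(2) by (simp add: mem_sub_iff)
    then show ?thesis by blast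
  qed (simp_all add: x(2) mem_sub_iff)
  ultimately have "H \<noteq> {\<one>}" by auto
  moreover have "n \<noteq> 1" using p_gt_1 by (simp add: n_eq)
  \<comment> \<open>The two rotation groups contain no reflection, and the \<open>Dih\<close> and
    \<open>RefSub\<close> groups miss r because neither \<open>p\<close> nor \<open>n\<close>
    divides 1.\<close>
  then have "rot 1 \<notin> H \<or> ref 0 \<notin> H"
    unfolding x(2) using p_gt_1 by (cases x) (simp_all add: mem_sub_iff)
  then have "H \<noteq> carrier G" by auto
  ultimately show "H \<in> {H. subgroup H G \<and> H \<noteq> {\<one>} \<and> H \<noteq> carrier G}" using H by simp
qed

lemma rot_p_mem_index_sub_iff: "rot (int p) \<in> index_sub x \<longleftrightarrow> (\<forall>i l. x \<noteq> RefSub i l)"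
  using not_n_dvd_p by (cases x) (simp_all add: mem_sub_iff)

text \<open>Membership in \<open>Dih j\<close> is tested modulo \<open>p\<close>, where only the low
  digit \<open>i\<close> survives; membership in a \<open>RefSub\<close> group is tested modulo
  \<open>n\<close>, where both digits count.\<close>

lemma ref_mem_index_sub_iff:
  assumes "i < p" "l < p" "x \<in> subgroup_indices p"
  shows "ref (int (i + p * l)) \<in> index_sub x \<longleftrightarrow> x = Dih i \<or> x = RefSub i l"
proof (cases x)
  case (Dih j)
  then have "j < p" using assms by simp
  have "int p dvd int (i + p * l) - int j \<longleftrightarrow> int p dvd int i - int j"
    using dvd_add_left_iff[of "int p" "int p * int l" "int i - int j"] by (simp add: algebra_simps)
  then show ?thesis
    using dvd_diff_less_iff[OF assms(1) \<open>j < p\<close>] Dih by (auto simp: mem_sub_iff)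
next
  case (RefSub j m)
  then have "j < p" "m < p" using assms by simp_all
  have "ref (int (i + p * l)) \<in> index_sub x
      \<longleftrightarrow> int n dvd int (i + p * l) - int (j + p * m)"
    unfolding RefSub index_sub.simps by (rule ref_mem_dih_sub_iff[OF dvd_refl])
  also have "\<dots> \<longleftrightarrow> i + p * l = j + p * m"
    using assms \<open>j < p\<close> \<open>m < p\<close> by (intro dvd_diff_less_iff RefSub_exp_less)
  also have "\<dots> \<longleftrightarrow> i = j \<and> l = m"
    by (rule RefSub_exp_eq_iff[OF assms(1) \<open>j < p\<close>])
  finally show ?thesis using RefSub by auto
qed (simp_all add: mem_sub_iff)

lemma index_sub_RefSub: "index_sub (RefSub i l) = {\<one>, ref (int (i + p * l))}"
proof -
  have "{rot k |k. int n dvd k} = {\<one>}" for j :: int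
    by (auto simp: one_eq rot_eq_iff intro: exI[of _ 0])
  moreover have "{ref k |k. int n dvd k - j} = {ref j}" for j
    by (auto simp: ref_eq_iff intro: exI[of _ j])
  ultimately show ?thesis by (simp add: dih_sub_def rot_sub_def insert_commute)
qed

lemma subgroup_index_sub: "subgroup (index_sub x) G"
  by (cases x) (simp_all only: index_sub.simps subgroup_rot_sub subgroup_dih_sub)

text \<open>A group of order two meets another subgroup non-trivially exactly when its reflection
  lies there. Any two of the remaining groups share r^p.\<close>

lemma index_sub_inter_iff:
  assumes "x \<in> subgroup_indices p" "y \<in> subgroup_indices p" "x \<noteq> y"
  shows "index_sub x \<inter> index_sub y \<noteq> {\<one>} \<longleftrightarrow> index_adj x y"
proof -
  have RefSub_case: "index_sub (RefSub i l) \<inter> index_sub y \<noteq> {\<one>} \<longleftrightarrow> y = Dih i"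
    if "RefSub i l \<in> subgroup_indices p" "y \<in> subgroup_indices p" "RefSub i l \<noteq> y" for i l y
  proof -
    have il: "i < p" "l < p" using that by simp_all
    have "ref (int (i + p * l)) \<noteq> \<one>" unfolding one_eq by (rule rot_neq_ref[symmetric])
    then have "index_sub (RefSub i l) \<inter> index_sub y \<noteq> {\<one>} \<longleftrightarrow> ref (int (i + p * l)) \<in> index_sub y"
      unfolding index_sub_RefSub using subgroup.one_closed[OF subgroup_index_sub[of y]] by blast
    then show ?thesis using ref_mem_index_sub_iff[OF il that(2)] that(3) by blast
  qed
  consider i l where "x = RefSub i l" | i l where "y = RefSub i l"
    | "\<forall>i l. x \<noteq> RefSub i l" "\<forall>i l. y \<noteq> RefSub i l" by blast
  then show ?thesis
  proof cases
    case 1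
    then show ?thesis using RefSub_case assms by simp
  next
    case 2
    then have "index_adj x y \<longleftrightarrow> x = Dih i" using assms(3) by (cases x) auto
    then show ?thesis using RefSub_case[of i l x] assms 2 by (simp add: Int_commute)
  next
    case 3
    then have "rot (int p) \<in> index_sub x \<inter> index_sub y" by (simp add: rot_p_mem_index_sub_iff)
    moreover have "rot (int p) \<noteq> \<one>" using not_n_dvd_p by (simp add: one_eq rot_eq_iff)
    moreover have "index_adj x y" using 3 by (cases x; cases y) auto
    ultimately show ?thesis by blast
  qed
qed

text \<open>Test elements separate the groups: r^p tells \<open>RefSub\<close> from the rest, its
  reflection then fixes both digits, r separates the rotation groups, and \<open>ref i\<close> with
  \<open>i < p\<close> singles out \<open>Dih i\<close>.\<close>

lemma inj_on_index_sub: "inj_on index_sub (subgroup_indices p)"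
proof (rule inj_onI)
  fix x y assume xy: "x \<in> subgroup_indices p" "y \<in> subgroup_indices p" "index_sub x = index_sub y"
  have *: "y = RefSub i l"
    if "RefSub i l \<in> subgroup_indices p" "y \<in> subgroup_indices p" "index_sub (RefSub i l) = index_sub y"
    for i l y
  proof -
    have "i < p" "l < p" using that by simp_all
    moreover have "ref (int (i + p * l)) \<in> index_sub y" using that(3) index_sub_RefSub by blast
    ultimately have "y = Dih i \<or> y = RefSub i l" using ref_mem_index_sub_iff that(2) by blast
    moreover have "rot (int p) \<notin> index_sub y"
      unfolding that(3)[symmetric] rot_p_mem_index_sub_iff by simp
    ultimately show ?thesis unfolding rot_p_mem_index_sub_iff by auto
  qed
  have rot1: "rot 1 \<in> index_sub RotAll" "rot 1 \<notin> index_sub RotSub"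
    using p_gt_1 by (simp_all add: mem_sub_iff)
  have Dih: "ref (int i) \<in> index_sub (Dih j) \<longleftrightarrow> i = j"
    if "Dih i \<in> subgroup_indices p" "Dih j \<in> subgroup_indices p" for i j
    using that dvd_diff_less_iff[of i p j] by (auto simp: mem_sub_iff)
  have ref: "ref i \<notin> index_sub RotAll" "ref i \<notin> index_sub RotSub" for i
    by (simp_all add: mem_sub_iff)
  show "x = y"
    using xy *[of _ _ x] *[of _ _ y] rot1 Dih ref
    by (cases x; cases y) (metis)+
qed

end

section \<open>Distances\<close>

text \<open>A potential criterion for distances: growth by at most 1 along arcs bounds every walk
  from below, and a predecessor one step closer to \<open>u\<close> yields a walk attaining the
  bound.\<close>

lemma gdist_eqI:
  fixes D :: "'i \<Rightarrow> 'i \<Rightarrow> nat"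
  assumes \<Gamma>: "pair_graph \<Gamma>" and verts: "pverts \<Gamma> = f ` I"
    and D_refl: "\<And>u. u \<in> I \<Longrightarrow> D u u = 0"
    and D_arc: "\<And>u x y. u \<in> I \<Longrightarrow> x \<in> I \<Longrightarrow> y \<in> I \<Longrightarrow> (f x, f y) \<in> parcs \<Gamma> \<Longrightarrow> D u y \<le> Suc (D u x)"
    and D_pred: "\<And>u v. u \<in> I \<Longrightarrow> v \<in> I \<Longrightarrow> u \<noteq> v \<Longrightarrow>
      \<exists>w\<in>I. (f w, f v) \<in> parcs \<Gamma> \<and> D u v = Suc (D u w)"
    and inj: "inj_on f I" and uv: "u \<in> I" "v \<in> I"
  shows "gdist \<Gamma> (f u) (f v) = ereal (real (D u v))"
proof -
  interpret pair_graph \<Gamma> by fact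
  have cost: "awalk_cost (\<lambda>_. 1) q = real (length q)" for q :: "('a \<times> 'a) awalk"
    by (induction q) auto
  \<comment> \<open>The start \<open>x\<close> is left free for the induction along the walk;
    \<open>x = u\<close> gives the bound because \<open>D u u = 0\<close>.\<close>
  have lower: "D u v \<le> D u x + length q" if "awalk (f x) q (f v)" "x \<in> I" for q x
    using that
  proof (induction q arbitrary: x)
    case Nil
    then show ?case using inj uv by (auto simp: awalk_Nil_iff dest: inj_onD)
  next
    case (Cons e q)
    obtain b where b: "(f x, b) \<in> parcs \<Gamma>" "awalk b q (f v)"
      using Cons.prems by (cases e) (auto simp: awalk_Cons_iff)
    moreover obtain y where y: "y \<in> I" "b = f y"
      using in_arcsD2[OF b(1)] verts by auto
    ultimately show ?case
      using Cons.IH[of y] D_arc[OF uv(1) Cons.prems(2) y(1)] by simp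
  qed
  have upper: "\<exists>q. awalk (f u) q (f v) \<and> length q = D u v" if "v \<in> I" for v
    using that
  proof (induction "D u v" arbitrary: v rule: less_induct)
    case less
    show ?case
    proof (cases "u = v")
      case True
      then show ?thesis using D_refl uv verts by (intro exI[of _ "[]"]) (auto simp: awalk_Nil_iff)
    next
      case False
      obtain w where w: "w \<in> I" "(f w, f v) \<in> parcs \<Gamma>" "D u v = Suc (D u w)"
        using D_pred[OF uv(1) less.prems False] by blast
      obtain q where "awalk (f u) q (f w)" "length q = D u w" using less.hyps w by force
      moreover have "awalk (f w) [(f w, f v)] (f v)"
        using w(2) in_arcsD1[OF w(2)] in_arcsD2[OF w(2)] by (auto simp: awalk_Cons_iff awalk_Nil_iff)
      ultimately show ?thesis
        using w(3) by (intro exI[of _ "q @ [(f w, f v)]"]) (simp add: awalk_appendI)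
    qed
  qed
  show ?thesis
    unfolding gdist_def \<mu>_def
  proof (rule antisym)
    obtain q where "awalk (f u) q (f v)" "length q = D u v" using upper uv by blast
    then show "(INF q\<in>{q. awalk (f u) q (f v)}. ereal (awalk_cost (\<lambda>_. 1) q)) \<le> ereal (real (D u v))"
      by (intro INF_lower2[of q]) (simp_all add: cost)
    show "ereal (real (D u v)) \<le> (INF q\<in>{q. awalk (f u) q (f v)}. ereal (awalk_cost (\<lambda>_. 1) q))"
      using lower[OF _ uv(1)] D_refl[OF uv(1)] by (intro INF_greatest) (auto simp: cost)
  qed
qed

section \<open>The hyper-Wiener index as a sum over ordered pairs\<close>

text \<open>Adding a vertex \<open>a\<close> adds the pairs in \<open>?E\<close> on the left, and a
  row and a column of the matrix \<open>h\<close> on the right. These agree by symmetry, and the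
  diagonal entry vanishes, whence the factor 1/2.\<close>

lemma sum_unordered_pairs:
  fixes g :: "'b set \<Rightarrow> real"
  assumes "finite I" "inj_on f I"
    and sym: "\<And>u v. u \<in> I \<Longrightarrow> v \<in> I \<Longrightarrow> h u v = h v u" and diag: "\<And>u. u \<in> I \<Longrightarrow> h u u = 0"
    and g: "\<And>u v. u \<in> I \<Longrightarrow> v \<in> I \<Longrightarrow> u \<noteq> v \<Longrightarrow> g {f u, f v} = h u v"
  shows "(\<Sum>e\<in>{{x, y} | x y. x \<in> f ` I \<and> y \<in> f ` I \<and> x \<noteq> y}. g e) = 1 / 2 * (\<Sum>u\<in>I. \<Sum>v\<in>I. h u v)"
  using assms
proof (induction I rule: finite_induct)
  case (insert a I)
  let ?P = "\<lambda>I. {{x, y} | x y. x \<in> f ` I \<and> y \<in> f ` I \<and> x \<noteq> y}"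
  let ?E = "(\<lambda>u. {f a, f u}) ` I"
  have fa: "f a \<notin> f ` I" using insert by auto
  have P: "?P (insert a I) = ?P I \<union> ?E" using fa by (auto simp: insert_commute)
  have fin: "finite (?P I)"
    by (rule finite_subset[of _ "Pow (f ` I)"]) (use insert.hyps in auto)
  have disj: "?P I \<inter> ?E = {}" using fa by (auto simp: doubleton_eq_iff)
  have inj: "inj_on (\<lambda>u. {f a, f u}) I"
    using insert.prems(1) by (auto simp: inj_on_def doubleton_eq_iff)
  have "sum g ?E = (\<Sum>u\<in>I. h a u)"
    unfolding sum.reindex[OF inj] o_def using insert.hyps by (intro sum.cong refl insert.prems(4)) auto
  moreover have "sum g (?P I) = 1 / 2 * (\<Sum>u\<in>I. \<Sum>v\<in>I. h u v)"
    using insert.prems by (intro insert.IH) (auto intro: inj_on_subset)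
  moreover have "(\<Sum>u\<in>I. h u a) = (\<Sum>u\<in>I. h a u)"
    by (intro sum.cong refl insert.prems(2)) auto
  moreover have "h a a = 0" by (rule insert.prems(3)) simp
  ultimately show ?case
    unfolding P sum.union_disjoint[OF fin finite_imageI[OF insert.hyps(1)] disj]
    using insert.hyps by (simp add: sum.distrib)
qed simp

text \<open>The factor 1/4 combines the 1/2 of the definition with the 1/2 from counting ordered
  pairs.\<close>

lemma hyper_wiener_index_eq:
  fixes D :: "'i \<Rightarrow> 'i \<Rightarrow> nat"
  assumes \<Gamma>: "pair_graph \<Gamma>" and "finite I" "inj_on f I" and verts: "pverts \<Gamma> = f ` I"
    and D: "\<And>u v. u \<in> I \<Longrightarrow> v \<in> I \<Longrightarrow> gdist \<Gamma> (f u) (f v) = ereal (real (D u v))"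
    and D_refl: "\<And>u. u \<in> I \<Longrightarrow> D u u = 0"
  shows "hyper_wiener_index \<Gamma> =
    ereal (1 / 4 * (\<Sum>u\<in>I. \<Sum>v\<in>I. real (D u v) + real (D u v) ^ 2))"
proof -
  \<comment> \<open>All distances are finite, so the sums can be computed in the reals.\<close>
  define g where "g e = real_of_ereal (pair_dist \<Gamma> e)" for e
  have g: "g {f u, f v} = real (D u v)" if "u \<in> I" "v \<in> I" for u v
    using that by (simp add: g_def pair_dist_eq[OF \<Gamma>] D)
  have pd: "pair_dist \<Gamma> e = ereal (g e)" if "e \<in> vertex_pairs \<Gamma>" for e
    using that D by (auto simp: vertex_pairs_def verts g_def pair_dist_eq[OF \<Gamma>])
  have sym: "D u v = D v u" if "u \<in> I" "v \<in> I" for u v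
    using gdist_commute[OF \<Gamma>, of "f u" "f v"] D that by simp
  have "hyper_wiener_index \<Gamma> =
      1 / 2 * ereal (\<Sum>e\<in>vertex_pairs \<Gamma>. g e) + 1 / 2 * ereal (\<Sum>e\<in>vertex_pairs \<Gamma>. g e ^ 2)"
    by (simp add: hyper_wiener_index_def wiener_index_def pd flip: sum_ereal)
  also have "\<dots> = ereal (1 / 2 * (\<Sum>e\<in>vertex_pairs \<Gamma>. g e + g e ^ 2))"
    by (simp add: sum.distrib distrib_left flip: divide_ereal_def)
  also have "(\<Sum>e\<in>vertex_pairs \<Gamma>. g e + g e ^ 2) =
      1 / 2 * (\<Sum>u\<in>I. \<Sum>v\<in>I. real (D u v) + real (D u v) ^ 2)"
    unfolding vertex_pairs_def verts
    by (rule sum_unordered_pairs) (use assms sym g in auto)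
  finally show ?thesis by simp
qed

section \<open>Evaluation of the double sum\<close>

lemma sum_subgroup_indices:
  "(\<Sum>x\<in>subgroup_indices p. h x) =
    h RotAll + h RotSub + (\<Sum>i<p. h (Dih i)) + (\<Sum>i<p. \<Sum>l<p. h (RefSub i l))"
  for h :: "subgroup_index \<Rightarrow> real"
proof -
  have "(\<Sum>x\<in>subgroup_indices p. h x) = sum h {RotAll, RotSub} + sum h (Dih ` {..<p})
      + sum h ((\<lambda>(i, l). RefSub i l) ` ({..<p} \<times> {..<p}))"
    unfolding subgroup_indices_def
    by (subst sum.union_disjoint; (subst sum.union_disjoint)?) auto
  then show ?thesis
    by (simp add: sum.reindex inj_on_def sum.cartesian_product case_prod_beta split_beta)
qed

lemma sum_single_out:
  fixes a b :: real
  assumes "i < p"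
  shows "(\<Sum>j<p. if i = j then a else b) = a + (real p - 1) * b"
proof -
  have "(\<Sum>j<p. if i = j then a else b) = a + (\<Sum>j\<in>{..<p} - {i}. if i = j then a else b)"
    using assms by (subst sum.remove[of _ i]) auto
  also have "(\<Sum>j\<in>{..<p} - {i}. if i = j then a else b) = (\<Sum>j\<in>{..<p} - {i}. b)"
    by (rule sum.cong) auto
  finally show ?thesis using assms by (simp add: of_nat_diff)
qed

text \<open>Distances 0, 1, 2, 3 carry the weights d + d^2 = 0, 2, 6, 12. The rows are summed by
  type of vertex: 2 rotation groups, p groups \<open>Dih\<close>, p^2 groups
  \<open>RefSub\<close>.\<close>

lemma sum_index_dist:
  "(\<Sum>u\<in>subgroup_indices p. \<Sum>v\<in>subgroup_indices p.
      real (index_dist u v) + real (index_dist u v) ^ 2)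
    = 2 * (6 * real p ^ 4 + 3 * real p ^ 3 + 6 * real p ^ 2 + 3 * real p + 2)"
proof -
  define F where "F u v = real (index_dist u v) + real (index_dist u v) ^ 2" for u v
  have F_Rot: "(\<Sum>v\<in>subgroup_indices p. F u v) = 2 + 2 * real p + 6 * real p ^ 2"
    if "u = RotAll \<or> u = RotSub" for u
    using that by (auto simp: sum_subgroup_indices F_def power2_eq_square)
  \<comment> \<open>The summands come from the two rotation groups, the other \<open>Dih\<close>
    vertices, the p attached pendants at distance 1, and the other pendants at distance 2.\<close>
  have F_Dih: "(\<Sum>v\<in>subgroup_indices p. F (Dih i) v) =
      4 + (real p - 1) * 2 + (real p * 2 + (real p - 1) * (real p * 6))" if "i < p" for i
  proof -
    have "F (Dih i) (Dih j) = (if i = j then 0 else 2)" for j by (simp add: F_def)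
    moreover have "(\<Sum>m<p. F (Dih i) (RefSub j m)) = (if i = j then real p * 2 else real p * 6)" for j
      by (simp add: F_def)
    moreover have "F (Dih i) RotAll = 2" "F (Dih i) RotSub = 2" by (simp_all add: F_def)
    ultimately show ?thesis
      unfolding sum_subgroup_indices by (simp only: sum_single_out[OF that])
  qed
  \<comment> \<open>The rotation groups give 6 each; then come the neighbour \<open>Dih i\<close>,
    the other \<open>Dih\<close> vertices, the p - 1 pendants at the same neighbour, and those at
    distance 3.\<close>
  have F_RefSub: "(\<Sum>v\<in>subgroup_indices p. F (RefSub i l) v) =
      12 + (2 + (real p - 1) * 6) + ((real p - 1) * 6 + (real p - 1) * (real p * 12))"
    if "i < p" "l < p" for i l
  proof -
    have "F (RefSub i l) (Dih j) = (if i = j then 2 else 6)" for j by (auto simp: F_def)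
    moreover have "(\<Sum>m<p. F (RefSub i l) (RefSub j m)) =
        (if i = j then (real p - 1) * 6 else real p * 12)" for j
    proof (cases "i = j")
      case True
      then have "F (RefSub i l) (RefSub j m) = (if l = m then 0 else 6)" for m by (simp add: F_def)
      then show ?thesis using True by (simp add: sum_single_out[OF that(2)])
    qed (simp add: F_def)
    moreover have "F (RefSub i l) RotAll = 6" "F (RefSub i l) RotSub = 6" by (simp_all add: F_def)
    ultimately show ?thesis
      unfolding sum_subgroup_indices by (simp only: sum_single_out[OF that(1)])
  qed
  have "(\<Sum>u\<in>subgroup_indices p. \<Sum>v\<in>subgroup_indices p. F u v)
    = 2 * (2 + 2 * real p + 6 * real p ^ 2)
      + real p * (4 + (real p - 1) * 2 + (real p * 2 + (real p - 1) * (real p * 6)))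
      + real p * (real p * (12 + (2 + (real p - 1) * 6)
          + ((real p - 1) * 6 + (real p - 1) * (real p * 12))))"
    by (simp add: sum_subgroup_indices[of "\<lambda>u. \<Sum>v\<in>_. F u v"] F_Rot F_Dih F_RefSub)
  then show ?thesis
    unfolding F_def by (simp add: algebra_simps power2_eq_square power3_eq_cube power4_eq_xxxx)
qed

theorem theorem3p2:
  fixes p n :: nat
  assumes "Factorial_Ring.prime p" and "n = p ^ 2"
  shows "hyper_wiener_index (intersection_graph (dihedral_group n)) =
    ereal (1 / 2 * (6 * real p ^ 4 + 3 * real p ^ 3 + 6 * real p ^ 2 + 3 * real p + 2))"
proof -
  let ?\<Gamma> = "intersection_graph (dihedral_group n)" and ?I = "subgroup_indices p"
  obtain rot ref where "dihedral (dihedral_group n) n rot ref"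
    using dihedral_dihedral_group by blast
  then interpret dihedral_prime_square "dihedral_group n" n rot ref p
    using assms by (simp add: dihedral_prime_square_def dihedral_prime_square_axioms_def)
  have \<Gamma>: "pair_graph ?\<Gamma>"
    by (rule pair_graph_intersection_graph[OF finite_carrier[OF n_pos]])
  have verts: "pverts ?\<Gamma> = index_sub ` ?I"
    by (simp add: intersection_graph_def proper_subgroups_eq)
  have fin: "finite ?I" by (simp add: subgroup_indices_def)
  have arcs: "(index_sub x, index_sub y) \<in> parcs ?\<Gamma> \<longleftrightarrow> x \<noteq> y \<and> index_adj x y"
    if "x \<in> ?I" "y \<in> ?I" for x y
    using that index_sub_inter_iff[OF that]
    by (simp add: intersection_graph_def proper_subgroups_eq inj_on_eq_iff[OF inj_on_index_sub]) blast
  have refl: "index_dist u u = 0" for u by (cases u) auto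
  have "gdist ?\<Gamma> (index_sub u) (index_sub v) = ereal (real (index_dist u v))"
    if "u \<in> ?I" "v \<in> ?I" for u v
    using \<Gamma> verts refl _ _ inj_on_index_sub that
  proof (rule gdist_eqI)
    fix u x y assume "u \<in> ?I" "x \<in> ?I" "y \<in> ?I" "(index_sub x, index_sub y) \<in> parcs ?\<Gamma>"
    then have "index_adj x y" by (simp add: arcs)
    then show "index_dist u y \<le> Suc (index_dist u x)"
      by (cases u; cases x; cases y) auto
  next
    fix u v assume uv: "u \<in> ?I" "v \<in> ?I" "u \<noteq> v"
    \<comment> \<open>This is the last vertex before \<open>v\<close> on a shortest path:
      \<open>u\<close> itself if adjacent, else the neighbour of a pendant \<open>v\<close>, else
      the neighbour of the pendant \<open>u\<close>. The final default cannot occur, since distinct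
      clique vertices are adjacent.\<close>
    define w where "w = (if index_adj u v then u else
      case v of RefSub i l \<Rightarrow> Dih i | _ \<Rightarrow> (case u of RefSub i l \<Rightarrow> Dih i | _ \<Rightarrow> u))"
    have "w \<in> ?I \<and> w \<noteq> v \<and> index_adj w v \<and> index_dist u v = Suc (index_dist u w)"
      using uv unfolding w_def by (cases u; cases v) auto
    then show "\<exists>w\<in>?I. (index_sub w, index_sub v) \<in> parcs ?\<Gamma> \<and> index_dist u v = Suc (index_dist u w)"
      using arcs uv by blast
  qed
  from hyper_wiener_index_eq[OF \<Gamma> fin inj_on_index_sub verts this refl] show ?thesis
    unfolding sum_index_dist by simp
qed

end
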